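(* Let $G=(V,E)$ be a strongly regular graph with parameters $(N,d,\alpha,\beta)$, $\beta\ge1$. Let $x\in V$, and let $A_{S_1(x)}$ be the adjacency matrix of the subgraph of $G$ induced by the set $S_1(x)$ of neighbours of $x$. Then, for any $\mathcal N\in(0,\infty]$, $$\mathcal K_{G,x}(\mathcal N)=2+\frac\alpha2-\frac{2d}{\mathcal N}+\left(\frac{2d(\beta-2)-\alpha^2}{2\beta}+\frac{2d}{\mathcal N}+\frac2\beta\min_{\lambda\in\sigma\left(A_{S_1(x)}|_{\mathbf 1^\perp}\right)}\left(\lambda-\frac\alpha2\right)^2\right)_-,$$ where the minimum is taken over all eigenvalues of $A_{S_1(x)}$ corresponding to eigenvectors in $\mathbf 1^\perp$, and $a_-:=\min\{0,a\}$ for $a\in\mathbb R$.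
   Context: For a locally finite simple graph $G=(V,E)$ and $f:V\to\mathbb R$ put $\Delta f(x)=\sum_{y\sim x}(f(y)-f(x))$ (non-normalized Laplacian), and for $f,g:V\to\mathbb R$ put $2\Gamma(f,g)=\Delta(fg)-f\Delta g-g\Delta f$, $2\Gamma_2(f,g)=\Delta\Gamma(f,g)-\Gamma(f,\Delta g)-\Gamma(\Delta f,g)$, $\Gamma(f)=\Gamma(f,f)$, $\Gamma_2(f)=\Gamma_2(f,f)$. For $\mathcal N\in(0,\infty]$ (convention $1/\infty=0$), $\mathcal K_{G,x}(\mathcal N)$ is the largest $K\in\mathbb R$ such that $\Gamma_2(f)(x)\ge\frac1{\mathcal N}(\Delta f(x))^2+K\,\Gamma(f)(x)$ for all $f:V\to\mathbb R$ (Bakry-Émery curvature function). A finite simple $d$-regular graph with $N$ vertices is strongly regular with parameters $(N,d,\alpha,\beta)$ if every two adjacent vertices have exactly $\alpha$ common neighbours and every two distinct non-adjacent vertices have exactly $\beta$ common neighbours. Complete graphs and disjoint unions of copies of a complete graph are regarded as the case $\beta=0$; it is assumed that $\beta\ge1$, so these are excluded. $\mathbf 1^\perp$ is the orthogonal complement of the all-ones vector in $\mathbb R^{S_1(x)}$; it is invariant under $A_{S_1(x)}$ since the induced subgraph on $S_1(x)$ is $\alpha$-regular. *)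

theory Defs
  imports Complex_Main "HOL-Library.Extended_Real"
begin

text \<open>
  A simple graph is a vertex set together with a symmetric, irreflexive adjacency relation living
  on it.  As adjacency never leaves the vertex set, a real function on the vertices may be taken
  to be a total function: its values elsewhere do not enter any of the operators below at a vertex.
\<close>

definition simple_graph :: "'a set \<Rightarrow> ('a \<Rightarrow> 'a \<Rightarrow> bool) \<Rightarrow> bool" where
  "simple_graph V adj \<longleftrightarrow>
     (\<forall>x y. adj x y \<longrightarrow> x \<in> V \<and> y \<in> V) \<and>
     (\<forall>x y. adj x y \<longrightarrow> adj y x) \<and>
     (\<forall>x. \<not> adj x x)"

definition nbrs :: "('a \<Rightarrow> 'a \<Rightarrow> bool) \<Rightarrow> 'a \<Rightarrow> 'a set" where
  "nbrs adj x = {y. adj x y}"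

definition laplacian :: "('a \<Rightarrow> 'a \<Rightarrow> bool) \<Rightarrow> ('a \<Rightarrow> real) \<Rightarrow> 'a \<Rightarrow> real" where
  "laplacian adj f x = (\<Sum>y\<in>nbrs adj x. f y - f x)"

definition Gamma :: "('a \<Rightarrow> 'a \<Rightarrow> bool) \<Rightarrow> ('a \<Rightarrow> real) \<Rightarrow> ('a \<Rightarrow> real) \<Rightarrow> 'a \<Rightarrow> real" where
  "Gamma adj f g x =
     (laplacian adj (\<lambda>y. f y * g y) x - f x * laplacian adj g x - g x * laplacian adj f x) / 2"

definition Gamma2 :: "('a \<Rightarrow> 'a \<Rightarrow> bool) \<Rightarrow> ('a \<Rightarrow> real) \<Rightarrow> ('a \<Rightarrow> real) \<Rightarrow> 'a \<Rightarrow> real" where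
  "Gamma2 adj f g x =
     (laplacian adj (Gamma adj f g) x - Gamma adj f (laplacian adj g) x
        - Gamma adj (laplacian adj f) g x) / 2"

text \<open>The dimension parameter ranges over \<open>(0, \<infinity>]\<close>; in \<^typ>\<open>ereal\<close> one has \<open>1 / \<infinity> = 0\<close>.\<close>

definition recip :: "ereal \<Rightarrow> real" where
  "recip \<N> = real_of_ereal (1 / \<N>)"

definition curvature_dimension ::
    "('a \<Rightarrow> 'a \<Rightarrow> bool) \<Rightarrow> 'a \<Rightarrow> real \<Rightarrow> ereal \<Rightarrow> bool" where
  "curvature_dimension adj x K \<N> \<longleftrightarrow>
     (\<forall>f :: 'a \<Rightarrow> real.
        Gamma2 adj f f x \<ge> recip \<N> * (laplacian adj f x)\<^sup>2 + K * Gamma adj f f x)"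

definition BE_curvature :: "('a \<Rightarrow> 'a \<Rightarrow> bool) \<Rightarrow> 'a \<Rightarrow> ereal \<Rightarrow> real" where
  "BE_curvature adj x \<N> = (GREATEST K. curvature_dimension adj x K \<N>)"

text \<open>
  For a complete graph the condition on non-adjacent pairs is vacuous; the last conjunct is the
  convention that such graphs have \<open>\<beta> = 0\<close>.  For disjoint unions of at least two
  copies of a complete graph \<open>\<beta> = 0\<close> follows from the condition on non-adjacent pairs.
\<close>

definition strongly_regular ::
    "'a set \<Rightarrow> ('a \<Rightarrow> 'a \<Rightarrow> bool) \<Rightarrow> nat \<Rightarrow> nat \<Rightarrow> nat \<Rightarrow> nat \<Rightarrow> bool" where
  "strongly_regular V adj N d \<alpha> \<beta> \<longleftrightarrow>
     simple_graph V adj \<and> finite V \<and> card V = N \<and>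
     (\<forall>x\<in>V. card (nbrs adj x) = d) \<and>
     (\<forall>x\<in>V. \<forall>y\<in>V. adj x y \<longrightarrow> card (nbrs adj x \<inter> nbrs adj y) = \<alpha>) \<and>
     (\<forall>x\<in>V. \<forall>y\<in>V. x \<noteq> y \<and> \<not> adj x y \<longrightarrow> card (nbrs adj x \<inter> nbrs adj y) = \<beta>) \<and>
     ((\<forall>x\<in>V. \<forall>y\<in>V. x \<noteq> y \<longrightarrow> adj x y) \<longrightarrow> \<beta> = 0)"

text \<open>
  Vectors in \<open>\<real>\<^sup>S\<close> and square matrices with index set \<open>S\<close> are given by total functions of which
  only the values at indices in \<open>S\<close> matter; in particular an eigenvector must be nonzero on \<open>S\<close>.
  The adjacency matrix of the subgraph induced by \<open>S\<close> is the submatrix of the adjacency matrix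
  with index set \<open>S\<close>.
\<close>

definition adj_matrix :: "('a \<Rightarrow> 'a \<Rightarrow> bool) \<Rightarrow> 'a \<Rightarrow> 'a \<Rightarrow> real" where
  "adj_matrix adj u v = (if adj u v then 1 else 0)"

definition eigenvector_on :: "'a set \<Rightarrow> ('a \<Rightarrow> 'a \<Rightarrow> real) \<Rightarrow> ('a \<Rightarrow> real) \<Rightarrow> real \<Rightarrow> bool" where
  "eigenvector_on S A h \<mu> \<longleftrightarrow>
     (\<exists>u\<in>S. h u \<noteq> 0) \<and> (\<forall>u\<in>S. (\<Sum>v\<in>S. A u v * h v) = \<mu> * h u)"

definition spectrum_ones_perp :: "'a set \<Rightarrow> ('a \<Rightarrow> 'a \<Rightarrow> real) \<Rightarrow> real set" where
  "spectrum_ones_perp S A = {\<mu>. \<exists>h. eigenvector_on S A h \<mu> \<and> (\<Sum>v\<in>S. h v) = 0}"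

definition neg_part :: "real \<Rightarrow> real" where
  "neg_part a = min 0 a"

end

theory Submission
  imports Defs "HOL-Analysis.Function_Topology"
begin

text \<open>
  Put \<open>S = S\<^sub>1(x)\<close>, \<open>a y = f y - f x\<close> and split \<open>a\<close> on \<open>S\<close> into its mean \<open>m\<close> and a part \<open>h\<close>
  orthogonal to the constants.  The values of \<open>a\<close> on the second sphere enter \<open>\<Gamma>\<^sub>2(f)(x)\<close> only
  through a sum of squares, which can be made \<open>0\<close>.  Since the numbers of common neighbours are
  determined by the parameters of the graph, what remains is a quadratic form on \<open>\<real>\<^sup>S\<close> that is a polynomial in the
  adjacency matrix \<open>A\<close> of \<open>S\<close> and in the all-ones matrix:
  \<open>2 \<Gamma>\<^sub>2(f)(x) = (2 + \<alpha>/2) d m\<^sup>2 + (2 + \<alpha>/2 + \<kappa>) |h|\<^sup>2 + (2/\<beta>) |A h - (\<alpha>/2) h|\<^sup>2\<close> with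
  \<open>\<kappa> = (2d(\<beta> - 2) - \<alpha>\<^sup>2) / (2\<beta>)\<close>, whereas \<open>2 \<Gamma>(f)(x) = d m\<^sup>2 + |h|\<^sup>2\<close> and \<open>\<Delta>f(x) = d m\<close>.  The
  optimal constant is the smaller one of those belonging to the constants and to their complement,
  the latter being given by the Rayleigh minimum of \<open>(A - \<alpha>/2)\<^sup>2\<close> on the complement.
\<close>

section \<open>Inner products and matrix action on a finite index set\<close>

definition inner_on :: "'a set \<Rightarrow> ('a \<Rightarrow> real) \<Rightarrow> ('a \<Rightarrow> real) \<Rightarrow> real" where
  "inner_on S f g = (\<Sum>v\<in>S. f v * g v)"

definition mat_vec :: "'a set \<Rightarrow> ('a \<Rightarrow> 'a \<Rightarrow> real) \<Rightarrow> ('a \<Rightarrow> real) \<Rightarrow> 'a \<Rightarrow> real" where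
  "mat_vec S A h u = (\<Sum>v\<in>S. A u v * h v)"

lemma inner_on_commute: "inner_on S f g = inner_on S g f"
  by (simp add: inner_on_def mult.commute)

lemma inner_on_add_left: "inner_on S (\<lambda>v. f v + g v) h = inner_on S f h + inner_on S g h"
  by (simp add: inner_on_def algebra_simps sum.distrib)

lemma inner_on_scale_left: "inner_on S (\<lambda>v. c * f v) g = c * inner_on S f g"
  by (simp add: inner_on_def algebra_simps sum_distrib_left)

lemma inner_on_add_right: "inner_on S h (\<lambda>v. f v + g v) = inner_on S h f + inner_on S h g"
  by (simp add: inner_on_def algebra_simps sum.distrib)

lemma inner_on_scale_right: "inner_on S g (\<lambda>v. c * f v) = c * inner_on S g f"
  by (simp add: inner_on_def algebra_simps sum_distrib_left)

lemmas inner_on_linear =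
  inner_on_add_left inner_on_scale_left inner_on_add_right inner_on_scale_right

lemma inner_on_cong:
  "(\<And>v. v \<in> S \<Longrightarrow> f v = f' v) \<Longrightarrow> (\<And>v. v \<in> S \<Longrightarrow> g v = g' v) \<Longrightarrow> inner_on S f g = inner_on S f' g'"
  by (simp add: inner_on_def)

lemma inner_on_self_nonneg: "0 \<le> inner_on S f f"
  by (simp add: inner_on_def sum_nonneg)

lemma inner_on_self_eq_0_iff: "finite S \<Longrightarrow> inner_on S f f = 0 \<longleftrightarrow> (\<forall>v\<in>S. f v = 0)"
  by (simp add: inner_on_def sum_nonneg_eq_0_iff)

lemma mat_vec_cong: "(\<And>v. v \<in> S \<Longrightarrow> f v = g v) \<Longrightarrow> mat_vec S A f u = mat_vec S A g u"
  by (simp add: mat_vec_def)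

lemma mat_vec_add: "mat_vec S A (\<lambda>v. f v + g v) u = mat_vec S A f u + mat_vec S A g u"
  by (simp add: mat_vec_def algebra_simps sum.distrib)

lemma mat_vec_scale: "mat_vec S A (\<lambda>v. c * f v) u = c * mat_vec S A f u"
  by (simp add: mat_vec_def algebra_simps sum_distrib_left)

lemma mat_vec_symmetric:
  assumes "\<And>u v. u \<in> S \<Longrightarrow> v \<in> S \<Longrightarrow> A u v = A v u"
  shows "inner_on S f (mat_vec S A g) = inner_on S (mat_vec S A f) g"
proof -
  have "inner_on S f (mat_vec S A g) = (\<Sum>u\<in>S. \<Sum>v\<in>S. f u * A u v * g v)"
    by (simp add: inner_on_def mat_vec_def sum_distrib_left algebra_simps)
  also have "\<dots> = (\<Sum>v\<in>S. \<Sum>u\<in>S. f u * A u v * g v)"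
    by (rule sum.swap)
  also have "\<dots> = (\<Sum>v\<in>S. \<Sum>u\<in>S. f u * A v u * g v)"
    using assms by (intro sum.cong refl) simp
  also have "\<dots> = inner_on S (mat_vec S A f) g"
    by (simp add: inner_on_def mat_vec_def sum_distrib_left algebra_simps)
  finally show ?thesis .
qed

text \<open>Equal column sums make the all-ones vector a left eigenvector, so the matrix maps its
  orthogonal complement into itself. This is the form in which the invariance of that complement is
  used.\<close>

lemma sum_mat_vec:
  assumes "\<And>v. v \<in> S \<Longrightarrow> (\<Sum>u\<in>S. A u v) = c"
  shows "(\<Sum>u\<in>S. mat_vec S A h u) = c * (\<Sum>v\<in>S. h v)"
proof -
  have "(\<Sum>u\<in>S. mat_vec S A h u) = (\<Sum>v\<in>S. \<Sum>u\<in>S. A u v * h v)"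
    unfolding mat_vec_def by (rule sum.swap)
  also have "\<dots> = (\<Sum>v\<in>S. c * h v)"
    using assms by (simp flip: sum_distrib_right)
  finally show ?thesis by (simp add: sum_distrib_left)
qed

section \<open>The Rayleigh minimum on the complement of the constants\<close>

text \<open>The unit sphere of the complement is compact, so the continuous quadratic form attains
  its minimum there. Scaling by the norm carries the bound over to every \<open>g\<close> orthogonal
  to the constants.\<close>

lemma rayleigh_minimum_attained:
  fixes S :: "'a set"
  assumes fin: "finite S" and card: "2 \<le> card S"
  obtains h where "(\<Sum>v\<in>S. h v) = 0" "inner_on S h h = 1"
    "\<And>g. (\<Sum>v\<in>S. g v) = 0 \<Longrightarrow>
       inner_on S h (mat_vec S M h) * inner_on S g g \<le> inner_on S g (mat_vec S M g)"
proof -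
  \<comment> \<open>Vectors are total functions on a possibly infinite type. Pinning the coordinates
    outside \<open>S\<close> to 0 makes \<open>K\<close> a product of compact sets, hence compact by
    Tychonoff.\<close>
  define K :: "('a \<Rightarrow> real) set" where "K = (\<Pi>\<^sub>E v\<in>UNIV. if v \<in> S then {-1..1} else {0})"
  define C where "C = K \<inter> {h. (\<Sum>v\<in>S. h v) = 0} \<inter> {h. inner_on S h h = 1}"
  have "compactin (product_topology (\<lambda>v. euclidean) UNIV) K"
    unfolding K_def by (subst compactin_PiE) simp
  then have "compact K"
    by (simp add: euclidean_product_topology)
  moreover have "closed {h :: 'a \<Rightarrow> real. (\<Sum>v\<in>S. h v) = 0}"
    by (intro closed_Collect_eq continuous_intros continuous_on_product_coordinates)
  moreover have "closed {h :: 'a \<Rightarrow> real. inner_on S h h = 1}"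
    unfolding inner_on_def
    by (intro closed_Collect_eq continuous_intros continuous_on_product_coordinates)
  ultimately have comp: "compact C"
    unfolding C_def by (intro compact_Int_closed)
  have normalize: "\<exists>g'\<in>C. \<exists>c. \<forall>v\<in>S. g v = c * g' v"
    if g: "(\<Sum>v\<in>S. g v) = 0" "inner_on S g g \<noteq> 0" for g
  proof -
    define c where "c = sqrt (inner_on S g g)"
    define g' where "g' v = (if v \<in> S then (1 / c) * g v else 0)" for v
    have c: "c > 0" "c\<^sup>2 = inner_on S g g"
      using g inner_on_self_nonneg[of S g] by (auto simp: c_def less_le)
    have "inner_on S g' g' = inner_on S (\<lambda>v. (1 / c) * g v) (\<lambda>v. (1 / c) * g v)"
      by (intro inner_on_cong) (auto simp: g'_def)
    also have "\<dots> = 1"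
      unfolding inner_on_linear c(2)[symmetric] using c(1) by (simp add: power2_eq_square)
    finally have one: "inner_on S g' g' = 1" .
    have "g' v \<in> {-1..1}" if "v \<in> S" for v
    proof -
      have "g' v * g' v \<le> inner_on S g' g'"
        unfolding inner_on_def using that fin by (intro member_le_sum) auto
      then have "\<bar>g' v\<bar> \<le> 1"
        using one by (simp add: abs_square_le_1 flip: power2_eq_square)
      then show ?thesis by auto
    qed
    moreover have "(\<Sum>v\<in>S. g' v) = (1 / c) * (\<Sum>v\<in>S. g v)"
      by (simp add: g'_def sum_distrib_left)
    ultimately have "g' \<in> C"
      using one g by (auto simp: C_def K_def PiE_iff g'_def)
    moreover have "\<forall>v\<in>S. g v = c * g' v"
      using c by (simp add: g'_def)
    ultimately show ?thesis by blast
  qed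
  obtain u w where uw: "u \<in> S" "w \<in> S" "u \<noteq> w"
    using card by (metis card_2_iff' card_le_Suc0_iff_eq fin not_less_eq_eq numeral_2_eq_2)
  \<comment> \<open>The bound on \<open>card S\<close> enters here: a difference of two standard
    basis vectors shows that the unit sphere of the complement is nonempty.\<close>
  define e where "e v = (if v = u then 1 else 0) - (if v = w then 1 else (0::real))" for v
  have "(\<Sum>v\<in>S. e v) = 0"
    using uw fin by (simp add: e_def sum_subtractf)
  moreover have "inner_on S e e \<noteq> 0"
    using uw fin by (subst inner_on_self_eq_0_iff) (auto simp: e_def)
  ultimately have "C \<noteq> {}"
    using normalize[of e] by blast
  moreover have "continuous_on C (\<lambda>h. inner_on S h (mat_vec S M h))"
    unfolding inner_on_def mat_vec_def
    by (intro continuous_intros continuous_on_product_then_coordinatewise[OF continuous_on_id])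
  ultimately obtain h where h: "h \<in> C"
    and min: "\<And>g. g \<in> C \<Longrightarrow> inner_on S h (mat_vec S M h) \<le> inner_on S g (mat_vec S M g)"
    using continuous_attains_inf[OF comp] by blast
  show thesis
  proof
    show "(\<Sum>v\<in>S. h v) = 0" "inner_on S h h = 1"
      using h by (auto simp: C_def)
    fix g :: "'a \<Rightarrow> real" assume g: "(\<Sum>v\<in>S. g v) = 0"
    show "inner_on S h (mat_vec S M h) * inner_on S g g \<le> inner_on S g (mat_vec S M g)"
    proof (cases "inner_on S g g = 0")
      case True
      then have "\<forall>v\<in>S. g v = 0" by (simp add: inner_on_self_eq_0_iff fin)
      then show ?thesis by (simp add: inner_on_def)
    next
      case False
      with g obtain g' c where g': "g' \<in> C" and gc: "\<forall>v\<in>S. g v = c * g' v"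
        using normalize by blast
      have "inner_on S g g = inner_on S (\<lambda>v. c * g' v) (\<lambda>v. c * g' v)"
        using gc by (intro inner_on_cong) auto
      then have norm: "inner_on S g g = c\<^sup>2"
        using g' by (simp add: C_def inner_on_linear power2_eq_square)
      have "inner_on S g (mat_vec S M g) = inner_on S (\<lambda>v. c * g' v) (\<lambda>u. c * mat_vec S M g' u)"
        using gc by (intro inner_on_cong) (simp_all add: mat_vec_def sum_distrib_left algebra_simps)
      then have "inner_on S g (mat_vec S M g) = c\<^sup>2 * inner_on S g' (mat_vec S M g')"
        by (simp add: inner_on_linear power2_eq_square)
      then show ?thesis
        using norm min[OF g'] by (simp add: mult.commute mult_left_mono)
    qed
  qed
qed

text \<open>The polynomial is minimal at \<open>t = 0\<close>, so its derivative \<open>b\<close>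
  there vanishes. Concretely, at \<open>t = - b / k\<close> with \<open>k\<close> larger than the
  absolute value of \<open>c\<close> the value is at most minus the square of
  \<open>b / k\<close>.\<close>

lemma linear_coefficient_eq_0:
  fixes b c :: real
  assumes "\<And>t. 0 \<le> b * t + c * t\<^sup>2"
  shows "b = 0"
proof -
  define k where "k = \<bar>c\<bar> + 1"
  have k: "k > 0" by (simp add: k_def)
  have "0 \<le> b * (- b / k) + c * (- b / k)\<^sup>2"
    by (rule assms)
  also have "\<dots> \<le> b * (- b / k) + (k - 1) * (- b / k)\<^sup>2"
    by (intro add_left_mono mult_right_mono) (auto simp: k_def)
  also have "\<dots> = - (b / k)\<^sup>2"
    using k by (simp add: field_simps power2_eq_square)
  finally show ?thesis
    using k by simp
qed

text \<open>The first variation at the minimizer \<open>h\<close> vanishes in all directions inside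
  the complement. The residual \<open>M h - \<mu> h\<close> is itself such a direction, because
  equal column sums keep \<open>M h\<close> in the complement; so it is orthogonal to
  itself.\<close>

lemma rayleigh_minimizer_eigenvector:
  assumes fin: "finite S" and card: "2 \<le> card S"
    and sym: "\<And>u v. u \<in> S \<Longrightarrow> v \<in> S \<Longrightarrow> M u v = M v u"
    and cols: "\<And>v. v \<in> S \<Longrightarrow> (\<Sum>u\<in>S. M u v) = c"
  obtains h \<mu> where "(\<Sum>v\<in>S. h v) = 0" "inner_on S h h = 1"
    "\<And>u. u \<in> S \<Longrightarrow> mat_vec S M h u = \<mu> * h u"
    "\<And>g. (\<Sum>v\<in>S. g v) = 0 \<Longrightarrow> \<mu> * inner_on S g g \<le> inner_on S g (mat_vec S M g)"
proof -
  obtain h where h: "(\<Sum>v\<in>S. h v) = 0" "inner_on S h h = 1"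
    and min: "\<And>g. (\<Sum>v\<in>S. g v) = 0 \<Longrightarrow>
       inner_on S h (mat_vec S M h) * inner_on S g g \<le> inner_on S g (mat_vec S M g)"
    using rayleigh_minimum_attained[OF fin card] by blast
  define \<mu> where "\<mu> = inner_on S h (mat_vec S M h)"
  define g where "g u = mat_vec S M h u + (- \<mu>) * h u" for u
  have g0: "(\<Sum>u\<in>S. g u) = 0"
    using sum_mat_vec[where S = S and A = M and h = h, OF cols] h
    by (simp add: g_def sum_subtractf flip: sum_distrib_left)
  \<comment> \<open>This is the minimality inequality for \<open>h + t g\<close>: its constant term
    vanishes by the choice of \<open>\<mu>\<close>, and symmetry of \<open>M\<close> turns the
    coefficient of \<open>t\<close> into twice the squared norm of \<open>g\<close>.\<close>
  have "0 \<le> (2 * inner_on S g g) * t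
      + (inner_on S g (mat_vec S M g) - \<mu> * inner_on S g g) * t\<^sup>2" for t
  proof -
    have "inner_on S g g = inner_on S g (mat_vec S M h) + (- \<mu>) * inner_on S g h"
      by (subst (2) g_def[abs_def]) (simp only: inner_on_linear)
    then have gh: "inner_on S g (mat_vec S M h) = inner_on S g g + \<mu> * inner_on S g h"
      by simp
    have "(\<Sum>u\<in>S. h u + t * g u) = 0"
      using h g0 by (simp add: sum.distrib flip: sum_distrib_left)
    from min[OF this]
    have "\<mu> * inner_on S (\<lambda>u. h u + t * g u) (\<lambda>u. h u + t * g u)
        \<le> inner_on S (\<lambda>u. h u + t * g u) (\<lambda>u. mat_vec S M h u + t * mat_vec S M g u)"
      by (simp add: \<mu>_def mat_vec_add mat_vec_scale cong: inner_on_cong)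
    moreover have "inner_on S h (mat_vec S M g) = inner_on S g (mat_vec S M h)"
      using mat_vec_symmetric[where A = M and S = S and f = h and g = g, OF sym] by (simp add: inner_on_commute)
    ultimately show ?thesis
      using gh h(2) unfolding inner_on_linear inner_on_commute[of S h g]
      by (simp add: \<mu>_def[symmetric] algebra_simps power2_eq_square)
  qed
  then have "inner_on S g g = 0"
    using linear_coefficient_eq_0 by force
  then have "\<forall>u\<in>S. g u = 0"
    by (simp add: inner_on_self_eq_0_iff fin)
  then show thesis
    using h min that[of h \<mu>] by (simp add: g_def \<mu>_def)
qed

section \<open>Eigenvalues on the complement of the constants\<close>

lemma eigenvector_on_iff:
  "eigenvector_on S A h \<mu> \<longleftrightarrow> (\<exists>u\<in>S. h u \<noteq> 0) \<and> (\<forall>u\<in>S. mat_vec S A h u = \<mu> * h u)"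
  by (simp add: eigenvector_on_def mat_vec_def)

text \<open>The Rayleigh minimum \<open>\<mu>\<close> is taken for \<open>M = B B\<close> with
  \<open>B = A - c I\<close>. It is an eigenvalue of \<open>M\<close>, and the factorization of
  \<open>M - \<mu> I\<close> into \<open>B - s I\<close> and \<open>B + s I\<close>, with
  \<open>s\<close> the square root of \<open>\<mu>\<close>, produces an eigenvalue of
  \<open>A\<close> at distance \<open>s\<close> from \<open>c\<close>.\<close>

lemma spectrum_ones_perp_attains_minimum:
  assumes fin: "finite S" and card: "2 \<le> card S"
    and sym: "\<And>u v. u \<in> S \<Longrightarrow> v \<in> S \<Longrightarrow> A u v = A v u"
    and cols: "\<And>v. v \<in> S \<Longrightarrow> (\<Sum>u\<in>S. A u v) = a"
  obtains \<theta> where "\<theta> \<in> spectrum_ones_perp S A"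
    "\<And>g. (\<Sum>v\<in>S. g v) = 0 \<Longrightarrow>
       (\<theta> - c)\<^sup>2 * inner_on S g g
         \<le> inner_on S (\<lambda>u. mat_vec S A g u - c * g u) (\<lambda>u. mat_vec S A g u - c * g u)"
proof -
  define B where "B u v = A u v - (if u = v then c else 0)" for u v
  define M where "M u w = (\<Sum>v\<in>S. B u v * B v w)" for u w
  have Bsym: "B u v = B v u" if "u \<in> S" "v \<in> S" for u v
    using sym that by (simp add: B_def)
  have Bcols: "(\<Sum>u\<in>S. B u v) = a - c" if "v \<in> S" for v
    using that fin cols by (simp add: B_def sum_subtractf)
  have B: "mat_vec S B h u = mat_vec S A h u - c * h u" if "u \<in> S" for h u
  proof -
    have "mat_vec S B h u = (\<Sum>v\<in>S. A u v * h v - (if u = v then c * h v else 0))"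
      unfolding mat_vec_def by (intro sum.cong) (auto simp: B_def algebra_simps)
    then show ?thesis
      using that fin by (simp add: sum_subtractf mat_vec_def)
  qed
  have M: "mat_vec S M h u = mat_vec S B (mat_vec S B h) u" for h u
  proof -
    have "mat_vec S M h u = (\<Sum>w\<in>S. \<Sum>v\<in>S. B u v * B v w * h w)"
      by (simp add: mat_vec_def M_def sum_distrib_right)
    also have "\<dots> = (\<Sum>v\<in>S. \<Sum>w\<in>S. B u v * B v w * h w)"
      by (rule sum.swap)
    finally show ?thesis
      by (simp add: mat_vec_def sum_distrib_left mult.assoc)
  qed
  have Msym: "M u w = M w u" if "u \<in> S" "w \<in> S" for u w
    unfolding M_def using that Bsym by (intro sum.cong) (auto simp: mult.commute)
  have Mcols: "(\<Sum>u\<in>S. M u w) = (a - c) * (a - c)" if "w \<in> S" for w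
  proof -
    have "(\<Sum>u\<in>S. M u w) = (\<Sum>v\<in>S. \<Sum>u\<in>S. B u v * B v w)"
      unfolding M_def by (rule sum.swap)
    also have "\<dots> = (\<Sum>v\<in>S. (a - c) * B v w)"
      using Bcols by (simp flip: sum_distrib_right)
    finally show ?thesis
      using Bcols that by (simp flip: sum_distrib_left)
  qed
  have quad: "inner_on S g (mat_vec S M g) = inner_on S (mat_vec S B g) (mat_vec S B g)" for g
    unfolding M[abs_def] by (rule mat_vec_symmetric[OF Bsym])
  obtain h \<mu> where h: "(\<Sum>v\<in>S. h v) = 0" "inner_on S h h = 1"
    and eig: "\<And>u. u \<in> S \<Longrightarrow> mat_vec S M h u = \<mu> * h u"
    and min: "\<And>g. (\<Sum>v\<in>S. g v) = 0 \<Longrightarrow> \<mu> * inner_on S g g \<le> inner_on S g (mat_vec S M g)"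
    using rayleigh_minimizer_eigenvector[where M = M and S = S, OF fin card Msym Mcols] by blast
  have "\<mu> = inner_on S h (\<lambda>u. \<mu> * h u)"
    using h by (simp add: inner_on_linear)
  also have "\<dots> = inner_on S h (mat_vec S M h)"
    using eig by (intro inner_on_cong) auto
  also have "\<dots> \<ge> 0"
    unfolding quad by (rule inner_on_self_nonneg)
  finally have mu: "\<mu> \<ge> 0" by simp
  define s where "s = sqrt \<mu>"
  have s: "s * s = \<mu>" using mu by (simp add: s_def)
  \<comment> \<open>Put \<open>k = (B + s I) h\<close>. If \<open>k\<close> vanishes on
    \<open>S\<close>, then \<open>h\<close> is an eigenvector of \<open>B\<close> for
    \<open>- s\<close>; otherwise \<open>(B - s I) k = (M - \<mu> I) h = 0\<close> makes
    \<open>k\<close> an eigenvector for \<open>s\<close>.\<close>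
  define k where "k u = mat_vec S B h u + s * h u" for u
  have "\<exists>\<theta>\<in>spectrum_ones_perp S A. (\<theta> - c)\<^sup>2 = \<mu>"
  proof (cases "\<forall>u\<in>S. k u = 0")
    case True
    have "eigenvector_on S A h (c - s)"
      unfolding eigenvector_on_iff
      using True h B inner_on_self_eq_0_iff[OF fin, of h] by (force simp: k_def algebra_simps)
    then have "c - s \<in> spectrum_ones_perp S A"
      using h by (auto simp: spectrum_ones_perp_def)
    then show ?thesis
      using s by (intro bexI[of _ "c - s"]) (auto simp: power2_eq_square)
  next
    case False
    have "mat_vec S B k u = s * k u" if "u \<in> S" for u
    proof -
      have "mat_vec S B k u = mat_vec S M h u + s * mat_vec S B h u"
        unfolding k_def[abs_def] mat_vec_add mat_vec_scale M ..
      then show ?thesis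
        using eig[OF that] s by (simp add: k_def algebra_simps)
    qed
    then have "eigenvector_on S A k (c + s)"
      unfolding eigenvector_on_iff using False B by (force simp: algebra_simps)
    moreover have "(\<Sum>u\<in>S. k u) = 0"
      using sum_mat_vec[where S = S and A = B and h = h, OF Bcols] h
      by (simp add: k_def sum.distrib flip: sum_distrib_left)
    ultimately have "c + s \<in> spectrum_ones_perp S A"
      by (auto simp: spectrum_ones_perp_def)
    then show ?thesis
      using s by (intro bexI[of _ "c + s"]) (auto simp: power2_eq_square)
  qed
  then obtain \<theta> where "\<theta> \<in> spectrum_ones_perp S A" "(\<theta> - c)\<^sup>2 = \<mu>" by blast
  moreover have "inner_on S (mat_vec S B g) (mat_vec S B g)
      = inner_on S (\<lambda>u. mat_vec S A g u - c * g u) (\<lambda>u. mat_vec S A g u - c * g u)" for g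
    by (intro inner_on_cong) (simp_all add: B)
  ultimately show thesis
    using that[of \<theta>] min quad by simp
qed

text \<open>
  Eigenvectors for distinct eigenvalues can be taken orthonormal; summing Bessel's inequality for
  the standard basis vectors bounds their number by the size of the index set.
\<close>

lemma finite_spectrum_ones_perp:
  assumes fin: "finite S" and sym: "\<And>u v. u \<in> S \<Longrightarrow> v \<in> S \<Longrightarrow> A u v = A v u"
  shows "finite (spectrum_ones_perp S A)"
proof -
  have "card F \<le> card S" if F: "F \<subseteq> spectrum_ones_perp S A" "finite F" for F
  proof -
    have "\<exists>h. inner_on S h h = 1 \<and> (\<forall>u\<in>S. mat_vec S A h u = \<mu> * h u)" if mu: "\<mu> \<in> F" for \<mu>
    proof -
      obtain h where h: "\<exists>u\<in>S. h u \<noteq> 0" "\<forall>u\<in>S. mat_vec S A h u = \<mu> * h u"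
        using subsetD[OF F(1) mu] by (auto simp: spectrum_ones_perp_def eigenvector_on_iff)
      define c where "c = sqrt (inner_on S h h)"
      have "inner_on S h h \<noteq> 0"
        using h inner_on_self_eq_0_iff[OF fin] by blast
      then have c: "c \<noteq> 0" "inner_on S h h = c * c"
        by (auto simp: c_def inner_on_self_nonneg)
      then have "inner_on S (\<lambda>u. (1 / c) * h u) (\<lambda>u. (1 / c) * h u) = 1"
        unfolding inner_on_linear c(2) by simp
      moreover have "\<forall>u\<in>S. mat_vec S A (\<lambda>u. (1 / c) * h u) u = \<mu> * ((1 / c) * h u)"
        unfolding mat_vec_scale using h by simp
      ultimately show ?thesis by blast
    qed
    then obtain e where norm: "\<And>\<mu>. \<mu> \<in> F \<Longrightarrow> inner_on S (e \<mu>) (e \<mu>) = 1"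
      and eig: "\<And>\<mu> u. \<mu> \<in> F \<Longrightarrow> u \<in> S \<Longrightarrow> mat_vec S A (e \<mu>) u = \<mu> * e \<mu> u"
      by metis
    have orth: "inner_on S (e \<mu>) (e \<nu>) = (if \<mu> = \<nu> then 1 else 0)" if "\<mu> \<in> F" "\<nu> \<in> F" for \<mu> \<nu>
    proof -
      have "\<nu> * inner_on S (e \<mu>) (e \<nu>) = inner_on S (e \<mu>) (mat_vec S A (e \<nu>))"
        unfolding inner_on_scale_right[symmetric] using eig that by (intro inner_on_cong) auto
      also have "\<dots> = inner_on S (mat_vec S A (e \<mu>)) (e \<nu>)"
        by (rule mat_vec_symmetric[OF sym])
      also have "\<dots> = \<mu> * inner_on S (e \<mu>) (e \<nu>)"
        unfolding inner_on_scale_left[symmetric] using eig that by (intro inner_on_cong) auto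
      finally show ?thesis using norm that by auto
    qed
    have bessel: "(\<Sum>\<mu>\<in>F. (e \<mu> u)\<^sup>2) \<le> 1" if u: "u \<in> S" for u
    proof -
      \<comment> \<open>\<open>p\<close> is the orthogonal projection of the standard basis vector
        at \<open>u\<close> onto the span of the vectors \<open>e \<mu>\<close>. Its squared norm
        equals its own entry \<open>p u\<close>, which forces \<open>p u \<le> 1\<close>.\<close>
      define p where "p v = (\<Sum>\<mu>\<in>F. e \<mu> u * e \<mu> v)" for v
      have "inner_on S p p = (\<Sum>v\<in>S. \<Sum>\<mu>\<in>F. \<Sum>\<nu>\<in>F. e \<mu> u * e \<nu> u * (e \<mu> v * e \<nu> v))"
        by (simp add: inner_on_def p_def sum_product algebra_simps)
      also have "\<dots> = (\<Sum>\<mu>\<in>F. \<Sum>v\<in>S. \<Sum>\<nu>\<in>F. e \<mu> u * e \<nu> u * (e \<mu> v * e \<nu> v))"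
        by (rule sum.swap)
      also have "\<dots> = (\<Sum>\<mu>\<in>F. \<Sum>\<nu>\<in>F. e \<mu> u * e \<nu> u * inner_on S (e \<mu>) (e \<nu>))"
        unfolding inner_on_def sum_distrib_left by (intro sum.cong refl sum.swap)
      also have "\<dots> = (\<Sum>\<mu>\<in>F. \<Sum>\<nu>\<in>F. if \<mu> = \<nu> then e \<mu> u * e \<nu> u else 0)"
        by (intro sum.cong refl) (simp add: orth)
      also have "\<dots> = (\<Sum>\<mu>\<in>F. (e \<mu> u)\<^sup>2)"
        using F by (simp add: power2_eq_square)
      finally have pp: "inner_on S p p = p u"
        by (simp add: p_def power2_eq_square)
      have "p u * p u \<le> inner_on S p p"
        unfolding inner_on_def using u fin by (intro member_le_sum) auto
      then have "p u * p u \<le> p u" by (simp only: pp)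
      moreover have "p u \<ge> 0" by (simp add: p_def sum_nonneg)
      ultimately have "p u \<le> 1"
        using mult_le_cancel_right[of "p u" "p u" 1] by (cases "p u = 0") auto
      then show ?thesis by (simp add: p_def power2_eq_square)
    qed
    have "real (card F) = (\<Sum>\<mu>\<in>F. inner_on S (e \<mu>) (e \<mu>))"
      using norm by simp
    also have "\<dots> = (\<Sum>u\<in>S. \<Sum>\<mu>\<in>F. (e \<mu> u)\<^sup>2)"
      unfolding inner_on_def power2_eq_square by (rule sum.swap)
    also have "\<dots> \<le> (\<Sum>u\<in>S. 1)"
      using bessel by (intro sum_mono)
    finally show ?thesis by simp
  qed
  then show ?thesis
    using finite_if_finite_subsets_card_bdd by blast
qed

section \<open>The gradient form and neighbour counts around a vertex\<close>

lemma Gamma_eq: "Gamma adj f g x = (\<Sum>y\<in>nbrs adj x. (f y - f x) * (g y - g x)) / 2"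
  unfolding Gamma_def laplacian_def sum_distrib_left sum_subtractf[symmetric]
  by (intro arg_cong[where f = "\<lambda>t. t / 2"] sum.cong refl) (simp add: algebra_simps)

locale srg_vertex =
  fixes V :: "'a set" and adj :: "'a \<Rightarrow> 'a \<Rightarrow> bool" and N d \<alpha> \<beta> :: nat and x :: 'a
  assumes srg: "strongly_regular V adj N d \<alpha> \<beta>"
    and beta: "\<beta> \<ge> 1"
    and x: "x \<in> V"
begin

abbreviation "S \<equiv> nbrs adj x"
text \<open>As \<beta> \<ge> 1, each of these vertices shares a neighbour with \<open>x\<close>. So
  \<open>T\<close> is the sphere of radius 2 about \<open>x\<close>, and no vertex lies farther
  away.\<close>

abbreviation "T \<equiv> V - insert x S"
abbreviation "A \<equiv> adj_matrix adj"

lemma finite_V: "finite V"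
  using srg by (simp add: strongly_regular_def)

lemma adj_sym: "adj u v \<longleftrightarrow> adj v u"
  using srg unfolding strongly_regular_def simple_graph_def by blast

lemma adj_irrefl: "\<not> adj u u"
  using srg unfolding strongly_regular_def simple_graph_def by blast

lemma nbrs_subset: "nbrs adj u \<subseteq> V"
  using srg unfolding strongly_regular_def simple_graph_def nbrs_def by blast

lemma finite_nbrs: "finite (nbrs adj u)"
  using finite_subset[OF nbrs_subset finite_V] .

lemma S_subset: "u \<in> S \<Longrightarrow> u \<in> V"
  using nbrs_subset by blast

lemma A_sym: "A u v = A v u"
  by (simp add: adj_matrix_def adj_sym)

lemma sum_nbrs: "(\<Sum>v\<in>nbrs adj u. g v) = (\<Sum>v\<in>V. A u v * g v)" for g :: "'a \<Rightarrow> real"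
proof -
  have "(\<Sum>v\<in>nbrs adj u. g v) = (\<Sum>v\<in>nbrs adj u. A u v * g v)"
    by (intro sum.cong) (auto simp: nbrs_def adj_matrix_def)
  also have "\<dots> = (\<Sum>v\<in>V. A u v * g v)"
    by (intro sum.mono_neutral_left finite_V nbrs_subset) (auto simp: nbrs_def adj_matrix_def)
  finally show ?thesis .
qed

text \<open>The three cases \<open>u = v\<close>, adjacent and non-adjacent are merged into one
  entry of \<beta> J + (\<alpha> - \<beta>) A + (d - \<beta>) I, with J the all-ones matrix. With
  this, \<open>sum_A_A\<close> below becomes the matrix identity for the square of A.\<close>

lemma card_common_nbrs:
  assumes "u \<in> V" "v \<in> V"
  shows "real (card (nbrs adj u \<inter> nbrs adj v)) =
    \<beta> + (real \<alpha> - \<beta>) * A u v + (if u = v then real d - \<beta> else 0)"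
  using assms srg by (auto simp: strongly_regular_def adj_matrix_def adj_irrefl)

lemma card_nbrs: "u \<in> V \<Longrightarrow> card (nbrs adj u) = d"
  using srg by (simp add: strongly_regular_def)

lemma sum_A: "u \<in> V \<Longrightarrow> (\<Sum>v\<in>V. A u v) = d"
  using sum_nbrs[of "\<lambda>_. 1" u] by (simp add: card_nbrs)

lemma sum_A_A:
  assumes "u \<in> V" "v \<in> V"
  shows "(\<Sum>z\<in>V. A z u * A z v) = \<beta> + (real \<alpha> - \<beta>) * A u v + (if u = v then real d - \<beta> else 0)"
proof -
  have "(\<Sum>z\<in>V. A z u * A z v) = (\<Sum>z\<in>nbrs adj u \<inter> nbrs adj v. A z u * A z v)"
  proof (intro sum.mono_neutral_right finite_V ballI)
    show "nbrs adj u \<inter> nbrs adj v \<subseteq> V"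
      using nbrs_subset by blast
  qed (auto simp: nbrs_def adj_matrix_def adj_sym)
  also have "\<dots> = (\<Sum>z\<in>nbrs adj u \<inter> nbrs adj v. 1)"
    by (intro sum.cong) (auto simp: nbrs_def adj_matrix_def adj_sym)
  finally show ?thesis
    using assms by (simp add: card_common_nbrs)
qed

lemma sum_A_S:
  assumes "u \<in> V"
  shows "(\<Sum>v\<in>S. A u v) = \<beta> + (real \<alpha> - \<beta>) * A x u + (if x = u then real d - \<beta> else 0)"
proof -
  have "(\<Sum>v\<in>S. A u v) = (\<Sum>v\<in>V. A v x * A v u)"
    unfolding sum_nbrs by (intro sum.cong refl) (metis A_sym)
  then show ?thesis
    using sum_A_A[OF x assms] by simp
qed

lemma sum_A_S_S: "u \<in> S \<Longrightarrow> (\<Sum>v\<in>S. A u v) = \<alpha>"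
  using sum_A_S[OF S_subset] by (auto simp: nbrs_def adj_matrix_def adj_irrefl)

lemma sum_A_T_S: "u \<in> T \<Longrightarrow> (\<Sum>v\<in>S. A u v) = \<beta>"
  using sum_A_S[of u] by (auto simp: nbrs_def adj_matrix_def)

lemma sum_V: "(\<Sum>v\<in>V. g v) = g x + (\<Sum>v\<in>S. g v) + (\<Sum>v\<in>T. g v)" for g :: "'a \<Rightarrow> real"
proof -
  have "V = insert x (S \<union> T)"
    using x nbrs_subset[of x] by auto
  then have "(\<Sum>v\<in>V. g v) = (\<Sum>v\<in>insert x (S \<union> T). g v)"
    by (rule arg_cong)
  also have "\<dots> = g x + (\<Sum>v\<in>S \<union> T. g v)"
    using finite_V finite_nbrs by (intro sum.insert) (auto simp: nbrs_def adj_irrefl)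
  also have "(\<Sum>v\<in>S \<union> T. g v) = (\<Sum>v\<in>S. g v) + (\<Sum>v\<in>T. g v)"
    using finite_V finite_nbrs by (intro sum.union_disjoint) auto
  finally show ?thesis by simp
qed

text \<open>Since \<beta> \<ge> 1 excludes complete graphs, some distinct vertices are non-adjacent;
  any common neighbour of theirs has degree at least 2. This makes the complement of the constants
  on \<open>S\<close> nonzero, so that it contains an eigenvector.\<close>

lemma degree_ge_2: "2 \<le> d"
proof -
  obtain u v where uv: "u \<in> V" "v \<in> V" "u \<noteq> v" "\<not> adj u v"
    using srg beta unfolding strongly_regular_def by (metis not_one_le_zero)
  then have "card (nbrs adj u \<inter> nbrs adj v) = \<beta>"
    using srg by (simp add: strongly_regular_def)
  with beta obtain w where w: "adj u w" "adj v w"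
    by (metis One_nat_def card.empty disjoint_iff mem_Collect_eq nbrs_def not_one_le_zero)
  then have "{u, v} \<subseteq> nbrs adj w" "w \<in> V"
    using nbrs_subset[of u] by (auto simp: nbrs_def adj_sym)
  then show ?thesis
    using card_mono[OF finite_nbrs, of "{u, v}" w] uv by (simp add: card_nbrs)
qed

section \<open>Gamma2 as a quadratic form\<close>

text \<open>The contributions of the walks x, y, z with \<open>y\<close> in \<open>S\<close> are
  regrouped by their endpoint \<open>z\<close>. Regularity collects the squares of
  \<open>a y\<close> into a multiple of the norm: 3/2 d from the inner sums less d/2 from Gamma at
  \<open>x\<close>.\<close>

lemma Gamma2_expansion:
  fixes f :: "'a \<Rightarrow> real"
  defines "a \<equiv> \<lambda>z. f z - f x"
  shows "2 * Gamma2 adj f f x = d * inner_on S a a + (\<Sum>y\<in>S. a y)\<^sup>2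
    + (\<Sum>z\<in>V. (\<Sum>y\<in>S. A z y) * (a z)\<^sup>2 / 2 - 2 * a z * mat_vec S A a z)"
proof -
  let ?L = "laplacian adj f"
  have Lx: "?L x = (\<Sum>y\<in>S. a y)"
    by (simp add: laplacian_def a_def)
  have L: "?L y = (\<Sum>z\<in>V. A y z * (a z - a y))" for y
    by (simp add: laplacian_def a_def sum_nbrs)
  have G: "Gamma adj f f y = (\<Sum>z\<in>V. A y z * (a z - a y)\<^sup>2) / 2" for y
    by (simp add: Gamma_eq a_def sum_nbrs power2_eq_square)
  have Gx: "Gamma adj f f x = inner_on S a a / 2"
    by (simp add: Gamma_eq a_def inner_on_def)
  have Gsym: "Gamma adj ?L f x = Gamma adj f ?L x"
    by (simp add: Gamma_eq mult.commute)
  have GL: "2 * Gamma adj f ?L x = (\<Sum>y\<in>S. a y * ?L y) - (\<Sum>y\<in>S. a y)\<^sup>2"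
  proof -
    have "2 * Gamma adj f ?L x = (\<Sum>y\<in>S. a y * ?L y - a y * ?L x)"
      by (simp add: Gamma_eq a_def right_diff_distrib)
    then show ?thesis
      by (simp add: sum_subtractf Lx power2_eq_square flip: sum_distrib_right)
  qed
  \<comment> \<open>In the factor 3/2, the summand 1/2 comes from the square in Gamma and the
    summand 1 from the product of \<open>a y\<close> with the Laplacian.\<close>
  have inner: "Gamma adj f f y - a y * ?L y
      = (\<Sum>z\<in>V. A y z * (a z)\<^sup>2 / 2 - 2 * a z * (A y z * a y)) + 3 / 2 * d * (a y * a y)"
    if y: "y \<in> S" for y
  proof -
    have "Gamma adj f f y - a y * ?L y
        = (\<Sum>z\<in>V. A y z * (a z - a y)\<^sup>2 / 2 - a y * (A y z * (a z - a y)))"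
      by (simp add: G L sum_subtractf sum_distrib_left sum_divide_distrib)
    also have "\<dots> = (\<Sum>z\<in>V. A y z * (a z)\<^sup>2 / 2 - 2 * a z * (A y z * a y)
        + A y z * (3 / 2 * (a y * a y)))"
      by (intro sum.cong refl) (simp add: power2_eq_square field_simps)
    finally show ?thesis
      by (simp only: sum.distrib sum_A[OF S_subset[OF y]] sum_distrib_right[symmetric])
  qed
  have "2 * Gamma2 adj f f x = (\<Sum>y\<in>S. Gamma adj f f y - Gamma adj f f x)
      - ((\<Sum>y\<in>S. a y * ?L y) - (\<Sum>y\<in>S. a y)\<^sup>2)"
    unfolding GL[symmetric] by (simp add: Gamma2_def Gsym laplacian_def)
  also have "\<dots> = (\<Sum>y\<in>S. Gamma adj f f y - a y * ?L y)
      - d * inner_on S a a / 2 + (\<Sum>y\<in>S. a y)\<^sup>2"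
    by (simp add: sum_subtractf Gx card_nbrs[OF x])
  also have "(\<Sum>y\<in>S. Gamma adj f f y - a y * ?L y)
      = (\<Sum>y\<in>S. \<Sum>z\<in>V. A y z * (a z)\<^sup>2 / 2 - 2 * a z * (A y z * a y))
        + 3 / 2 * d * inner_on S a a"
    unfolding inner_on_def sum_distrib_left sum.distrib[symmetric] by (intro sum.cong refl inner)
  also have "(\<Sum>y\<in>S. \<Sum>z\<in>V. A y z * (a z)\<^sup>2 / 2 - 2 * a z * (A y z * a y))
      = (\<Sum>z\<in>V. \<Sum>y\<in>S. A z y * (a z)\<^sup>2 / 2 - 2 * a z * (A z y * a y))"
    by (subst sum.swap) (simp add: A_sym)
  also have "\<dots> = (\<Sum>z\<in>V. (\<Sum>y\<in>S. A z y) * (a z)\<^sup>2 / 2 - 2 * a z * mat_vec S A a z)"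
    by (simp add: sum_subtractf mat_vec_def sum_distrib_left sum_distrib_right sum_divide_distrib)
  finally show ?thesis by (simp add: field_simps)
qed

text \<open>Here \<open>mat_vec S A a\<close> is evaluated on all of \<open>V\<close>. The identity
  for the square of A gives its squared norm over \<open>V\<close>; removing the contribution of
  \<open>x\<close>, which is the squared sum of \<open>a\<close>, and that of \<open>S\<close>
  leaves \<open>T\<close>.\<close>

lemma sum_mat_vec_T_squares:
  "(\<Sum>z\<in>T. (mat_vec S A a z)\<^sup>2) = (real \<beta> - 1) * (\<Sum>y\<in>S. a y)\<^sup>2
    + (real \<alpha> - \<beta>) * inner_on S a (mat_vec S A a) + (real d - \<beta>) * inner_on S a a
    - inner_on S (mat_vec S A a) (mat_vec S A a)"
proof -
  have "(\<Sum>z\<in>V. (mat_vec S A a z)\<^sup>2) = (\<Sum>z\<in>V. \<Sum>u\<in>S. \<Sum>v\<in>S. a u * a v * (A z u * A z v))"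
    by (simp add: mat_vec_def power2_eq_square sum_product algebra_simps)
  also have "\<dots> = (\<Sum>u\<in>S. \<Sum>z\<in>V. \<Sum>v\<in>S. a u * a v * (A z u * A z v))"
    by (rule sum.swap)
  also have "\<dots> = (\<Sum>u\<in>S. \<Sum>v\<in>S. a u * a v * (\<Sum>z\<in>V. A z u * A z v))"
    unfolding sum_distrib_left by (intro sum.cong refl sum.swap)
  also have "\<dots> = (\<Sum>u\<in>S. \<Sum>v\<in>S. \<beta> * (a u * a v) + (real \<alpha> - \<beta>) * (a u * (A u v * a v))
      + (if u = v then (real d - \<beta>) * (a u * a v) else 0))"
    by (intro sum.cong refl) (simp add: sum_A_A S_subset algebra_simps)
  also have "\<dots> = \<beta> * (\<Sum>y\<in>S. a y)\<^sup>2 + (real \<alpha> - \<beta>) * inner_on S a (mat_vec S A a)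
      + (real d - \<beta>) * inner_on S a a"
    by (simp add: sum.distrib finite_nbrs inner_on_def mat_vec_def power2_eq_square sum_product
        flip: sum_distrib_left)
  finally have V: "(\<Sum>z\<in>V. (mat_vec S A a z)\<^sup>2) = \<dots>" .
  have "mat_vec S A a x = (\<Sum>y\<in>S. a y)"
    unfolding mat_vec_def by (intro sum.cong) (auto simp: nbrs_def adj_matrix_def)
  then show ?thesis
    using V unfolding sum_V by (simp add: inner_on_def power2_eq_square algebra_simps)
qed

text \<open>
  The values of \<open>f\<close> on the second sphere enter only through the square
  completed in the last summand.
\<close>

lemma Gamma2_complete_square:
  fixes f :: "'a \<Rightarrow> real"
  defines "a \<equiv> \<lambda>z. f z - f x"
  defines "b \<equiv> \<lambda>u. mat_vec S A a u - \<alpha> / 2 * a u"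
  shows "2 * Gamma2 adj f f x =
      (2 + \<alpha> / 2 + (2 * real d * (real \<beta> - 2) - (real \<alpha>)\<^sup>2) / (2 * real \<beta>)) * inner_on S a a
    + (2 / \<beta> - 1) * (\<Sum>y\<in>S. a y)\<^sup>2 + 2 / \<beta> * inner_on S b b
    + (\<Sum>z\<in>T. \<beta> / 2 * (a z - 2 / \<beta> * mat_vec S A a z)\<^sup>2)"
proof -
  have b0: "real \<beta> > 0" using beta by simp
  have ax: "a x = 0" by (simp add: a_def)
  let ?p = "inner_on S a a" and ?q = "inner_on S a (mat_vec S A a)"
    and ?r = "inner_on S (mat_vec S A a) (mat_vec S A a)" and ?\<sigma> = "\<Sum>y\<in>S. a y"
  have "(\<Sum>z\<in>V. (\<Sum>y\<in>S. A z y) * (a z)\<^sup>2 / 2 - 2 * a z * mat_vec S A a z)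
      = (\<Sum>z\<in>S. \<alpha> / 2 * (a z * a z) - 2 * (a z * mat_vec S A a z))
        + (\<Sum>z\<in>T. \<beta> * (a z)\<^sup>2 / 2 - 2 * a z * mat_vec S A a z)"
    unfolding sum_V using ax by (simp add: sum_A_S_S sum_A_T_S power2_eq_square mult.assoc)
  also have "(\<Sum>z\<in>S. \<alpha> / 2 * (a z * a z) - 2 * (a z * mat_vec S A a z)) = \<alpha> / 2 * ?p - 2 * ?q"
    by (simp only: sum_subtractf inner_on_def sum_distrib_left)
  also have "(\<Sum>z\<in>T. \<beta> * (a z)\<^sup>2 / 2 - 2 * a z * mat_vec S A a z)
      = (\<Sum>z\<in>T. \<beta> / 2 * (a z - 2 / \<beta> * mat_vec S A a z)\<^sup>2 - 2 / \<beta> * (mat_vec S A a z)\<^sup>2)"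
    using b0 by (intro sum.cong refl) (simp add: power2_eq_square field_simps)
  also have "\<dots> = (\<Sum>z\<in>T. \<beta> / 2 * (a z - 2 / \<beta> * mat_vec S A a z)\<^sup>2)
      - 2 / \<beta> * ((real \<beta> - 1) * ?\<sigma>\<^sup>2 + (real \<alpha> - \<beta>) * ?q + (real d - \<beta>) * ?p - ?r)"
    by (simp only: sum_subtractf sum_mat_vec_T_squares[symmetric] sum_distrib_left)
  finally have G2: "2 * Gamma2 adj f f x = d * ?p + ?\<sigma>\<^sup>2 + (\<alpha> / 2 * ?p - 2 * ?q
      + ((\<Sum>z\<in>T. \<beta> / 2 * (a z - 2 / \<beta> * mat_vec S A a z)\<^sup>2)
      - 2 / \<beta> * ((real \<beta> - 1) * ?\<sigma>\<^sup>2 + (real \<alpha> - \<beta>) * ?q + (real d - \<beta>) * ?p - ?r)))"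
    unfolding Gamma2_expansion a_def by (rule arg_cong)
  \<comment> \<open>The shift by \<alpha>/2 is the one for which the mixed terms \<open>?q\<close>
    cancel: their coefficient in \<open>G2\<close> is -2\<alpha>/\<beta>, and rewriting
    \<open>?r\<close> through \<open>b\<close> adds 2\<alpha>/\<beta>.\<close>
  have "inner_on S b b = ?r - \<alpha> * ?q + (real \<alpha>)\<^sup>2 / 4 * ?p"
  proof -
    have "inner_on S b b = inner_on S (\<lambda>u. mat_vec S A a u + (- \<alpha> / 2) * a u)
        (\<lambda>u. mat_vec S A a u + (- \<alpha> / 2) * a u)"
      by (simp add: b_def)
    also have "\<dots> = ?r - \<alpha> * ?q + (real \<alpha>)\<^sup>2 / 4 * ?p"
      unfolding inner_on_linear inner_on_commute[of S "mat_vec S A a" a]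
      by (simp add: power2_eq_square field_simps)
    finally show ?thesis .
  qed
  then have r: "?r = inner_on S b b + \<alpha> * ?q - (real \<alpha>)\<^sup>2 / 4 * ?p"
    by simp
  define R where "R = (\<Sum>z\<in>T. \<beta> / 2 * (a z - 2 / \<beta> * mat_vec S A a z)\<^sup>2)"
  show ?thesis
    unfolding G2 R_def[symmetric] r using b0 by (simp add: power2_eq_square field_simps)
qed

text \<open>The graph induced on \<open>S\<close> is \<alpha>-regular, so its adjacency matrix
  respects the splitting into mean and complement. No cross terms between \<open>m\<close> and
  \<open>h\<close> arise within \<open>S\<close>.\<close>

lemma Gamma2_decomposition:
  fixes f h :: "'a \<Rightarrow> real" and m :: real
  assumes f: "\<forall>y\<in>S. f y - f x = h y + m" and h: "(\<Sum>y\<in>S. h y) = 0"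
  defines "b \<equiv> \<lambda>u. mat_vec S A h u - \<alpha> / 2 * h u"
  shows "laplacian adj f x = d * m"
    and "2 * Gamma adj f f x = d * m\<^sup>2 + inner_on S h h"
    and "2 * Gamma2 adj f f x = (2 + \<alpha> / 2) * (d * m\<^sup>2)
      + (2 + \<alpha> / 2 + (2 * real d * (real \<beta> - 2) - (real \<alpha>)\<^sup>2) / (2 * real \<beta>)) * inner_on S h h
      + 2 / \<beta> * inner_on S b b
      + (\<Sum>z\<in>T. \<beta> / 2 * (f z - f x - 2 / \<beta> * mat_vec S A (\<lambda>y. h y + m) z)\<^sup>2)"
proof -
  have b0: "real \<beta> > 0" using beta by simp
  let ?a = "\<lambda>z. f z - f x"
  have sigma: "(\<Sum>y\<in>S. ?a y) = d * m"
    using f h by (simp add: sum.distrib card_nbrs[OF x])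
  show "laplacian adj f x = d * m"
    using sigma by (simp add: laplacian_def)
  have pythagoras: "inner_on S (\<lambda>u. g u + c) (\<lambda>u. g u + c) = inner_on S g g + d * c\<^sup>2"
    if "(\<Sum>y\<in>S. g y) = 0" for g and c :: real
  proof -
    have "inner_on S (\<lambda>u. g u + c) (\<lambda>u. g u + c)
        = (\<Sum>u\<in>S. g u * g u + 2 * c * g u + c\<^sup>2)"
      unfolding inner_on_def by (intro sum.cong refl) (simp add: power2_eq_square algebra_simps)
    then show ?thesis
      using that by (simp add: sum.distrib inner_on_def card_nbrs[OF x] flip: sum_distrib_left)
  qed
  have aa: "inner_on S ?a ?a = inner_on S h h + d * m\<^sup>2"
    unfolding pythagoras[OF h, symmetric] using f by (intro inner_on_cong) simp_all
  then show "2 * Gamma adj f f x = d * m\<^sup>2 + inner_on S h h"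
    by (simp add: Gamma_eq inner_on_def)
  have mv: "mat_vec S A ?a u = mat_vec S A (\<lambda>y. h y + m) u" for u
    using f by (intro mat_vec_cong) simp
  have "mat_vec S A ?a u - \<alpha> / 2 * ?a u = b u + \<alpha> / 2 * m" if "u \<in> S" for u
  proof -
    have "mat_vec S A (\<lambda>_. m) u = \<alpha> * m"
      by (simp add: mat_vec_def sum_A_S_S[OF that] flip: sum_distrib_right)
    then show ?thesis
      unfolding mv mat_vec_add using bspec[OF f that] by (simp add: b_def field_simps)
  qed
  then have "inner_on S (\<lambda>u. mat_vec S A ?a u - \<alpha> / 2 * ?a u) (\<lambda>u. mat_vec S A ?a u - \<alpha> / 2 * ?a u)
      = inner_on S (\<lambda>u. b u + \<alpha> / 2 * m) (\<lambda>u. b u + \<alpha> / 2 * m)"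
    by (intro inner_on_cong)
  also have "\<dots> = inner_on S b b + d * (\<alpha> / 2 * m)\<^sup>2"
  proof (rule pythagoras)
    have "(\<Sum>u\<in>S. mat_vec S A h u) = \<alpha> * (\<Sum>v\<in>S. h v)"
      using sum_A_S_S by (intro sum_mat_vec) (simp add: A_sym)
    then show "(\<Sum>y\<in>S. b y) = 0"
      unfolding b_def sum_subtractf sum_distrib_left[symmetric] using h by simp
  qed
  \<comment> \<open>In the mean direction the fraction in the second line is cancelled by (2/\<beta>
    - 1) d from the squared sum and \<alpha>^2/(2\<beta>) from \<open>b\<close>, leaving only 2 +
    \<alpha>/2.\<close>
  finally show "2 * Gamma2 adj f f x = (2 + \<alpha> / 2) * (d * m\<^sup>2)
      + (2 + \<alpha> / 2 + (2 * real d * (real \<beta> - 2) - (real \<alpha>)\<^sup>2) / (2 * real \<beta>)) * inner_on S h h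
      + 2 / \<beta> * inner_on S b b
      + (\<Sum>z\<in>T. \<beta> / 2 * (f z - f x - 2 / \<beta> * mat_vec S A (\<lambda>y. h y + m) z)\<^sup>2)"
    unfolding Gamma2_complete_square[of f] aa sigma mv
    using b0 by (simp add: power2_eq_square field_simps)
qed

section \<open>The optimal curvature constant\<close>

lemma curvature_dimension_necessary:
  fixes h :: "'a \<Rightarrow> real" and m :: real
  assumes cd: "curvature_dimension adj x K \<N>" and h: "(\<Sum>y\<in>S. h y) = 0"
  defines "b \<equiv> \<lambda>u. mat_vec S A h u - \<alpha> / 2 * h u"
  shows "2 * recip \<N> * (d * m)\<^sup>2 + K * (d * m\<^sup>2 + inner_on S h h) \<le> (2 + \<alpha> / 2) * (d * m\<^sup>2)
      + (2 + \<alpha> / 2 + (2 * real d * (real \<beta> - 2) - (real \<alpha>)\<^sup>2) / (2 * real \<beta>)) * inner_on S h h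
      + 2 / \<beta> * inner_on S b b"
proof -
  \<comment> \<open>The values on \<open>T\<close> are the zeros of the completed squares, so this
    extension of the data on \<open>S\<close> minimizes Gamma2.\<close>
  define f where "f z = (if z = x then 0 else if z \<in> S then h z + m
    else 2 / \<beta> * mat_vec S A (\<lambda>y. h y + m) z)" for z
  have fS: "\<forall>y\<in>S. f y - f x = h y + m"
    by (auto simp: f_def nbrs_def adj_irrefl)
  have "(\<Sum>z\<in>T. \<beta> / 2 * (f z - f x - 2 / \<beta> * mat_vec S A (\<lambda>y. h y + m) z)\<^sup>2) = 0"
    by (intro sum.neutral) (simp add: f_def)
  then have G2: "2 * Gamma2 adj f f x = (2 + \<alpha> / 2) * (d * m\<^sup>2)
      + (2 + \<alpha> / 2 + (2 * real d * (real \<beta> - 2) - (real \<alpha>)\<^sup>2) / (2 * real \<beta>)) * inner_on S h h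
      + 2 / \<beta> * inner_on S b b"
    using Gamma2_decomposition(3)[OF fS h, folded b_def] by simp
  have "recip \<N> * (laplacian adj f x)\<^sup>2 + K * Gamma adj f f x \<le> Gamma2 adj f f x"
    using cd by (simp add: curvature_dimension_def)
  then have "2 * (recip \<N> * (laplacian adj f x)\<^sup>2) + K * (2 * Gamma adj f f x) \<le> 2 * Gamma2 adj f f x"
    by simp
  then show ?thesis
    unfolding G2 Gamma2_decomposition(1,2)[OF fS h] by (simp only: mult.assoc)
qed

text \<open>The constants and their complement impose the upper bounds \<open>?u\<close> and
  \<open>?v\<close> on \<open>K\<close>, and the smaller of them is
  \<open>?u + neg_part (?v - ?u)\<close>. As an equivalence this describes all admissible
  \<open>K\<close>, so the greatest one can be read off.\<close>

lemma curvature_dimension_iff: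
  defines "P \<equiv> spectrum_ones_perp S A"
  shows "curvature_dimension adj x K \<N> \<longleftrightarrow>
    K \<le> 2 + real \<alpha> / 2 - 2 * real d * recip \<N>
    + neg_part ((2 * real d * (real \<beta> - 2) - (real \<alpha>)\<^sup>2) / (2 * real \<beta>)
         + 2 * real d * recip \<N> + 2 / real \<beta> * Min ((\<lambda>\<mu>. (\<mu> - real \<alpha> / 2)\<^sup>2) ` P))"
proof -
  let ?\<kappa> = "(2 * real d * (real \<beta> - 2) - (real \<alpha>)\<^sup>2) / (2 * real \<beta>)"
  let ?r = "recip \<N>" and ?g = "\<lambda>\<mu>. (\<mu> - real \<alpha> / 2)\<^sup>2"
  let ?b = "\<lambda>h u. mat_vec S A h u - \<alpha> / 2 * h u"
  define \<rho> where "\<rho> = Min (?g ` P)"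
  have b0: "real \<beta> > 0" and d0: "real d > 0" using beta degree_ge_2 by auto
  \<comment> \<open>\<open>Min\<close> is a true minimum only on a finite nonempty set: finiteness
    is shown here, and \<open>\<theta>\<close> below witnesses nonemptiness.\<close>
  have finP: "finite P"
    unfolding P_def by (intro finite_spectrum_ones_perp finite_nbrs A_sym)
  have card: "2 \<le> card S" using degree_ge_2 by (simp add: card_nbrs[OF x])
  have cols: "(\<Sum>u\<in>S. A u v) = \<alpha>" if "v \<in> S" for v
    using sum_A_S_S[OF that] by (simp add: A_sym)
  obtain \<theta> where \<theta>: "\<theta> \<in> P"
    and min: "\<And>g. (\<Sum>v\<in>S. g v) = 0 \<Longrightarrow> ?g \<theta> * inner_on S g g \<le> inner_on S (?b g) (?b g)"
    using spectrum_ones_perp_attains_minimum[where S = S and A = A and a = \<alpha> and c = "\<alpha> / 2",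
      OF finite_nbrs card A_sym cols] unfolding P_def by blast
  have \<rho>: "\<rho> * inner_on S g g \<le> inner_on S (?b g) (?b g)" if "(\<Sum>v\<in>S. g v) = 0" for g
  proof -
    have "\<rho> \<le> ?g \<theta>"
      unfolding \<rho>_def using \<theta> finP by (intro Min_le) auto
    then have "\<rho> * inner_on S g g \<le> ?g \<theta> * inner_on S g g"
      by (intro mult_right_mono inner_on_self_nonneg)
    with min[OF that] show ?thesis by simp
  qed
  \<comment> \<open>An eigenvector \<open>k\<close> belonging to the minimum turns the Rayleigh
    bound into an equality and thus serves as the test vector for \<open>?v\<close>.\<close>
  have "\<rho> \<in> ?g ` P"
    unfolding \<rho>_def using \<theta> finP by (intro Min_in) auto
  then obtain \<mu> k where \<mu>: "\<rho> = ?g \<mu>" and k: "eigenvector_on S A k \<mu>" "(\<Sum>v\<in>S. k v) = 0"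
    by (auto simp: P_def spectrum_ones_perp_def)
  have "curvature_dimension adj x K \<N> \<longleftrightarrow>
      K \<le> 2 + \<alpha> / 2 - 2 * d * ?r \<and> K \<le> 2 + \<alpha> / 2 + ?\<kappa> + 2 / \<beta> * \<rho>" (is "_ \<longleftrightarrow> K \<le> ?u \<and> K \<le> ?v")
  proof
    assume cd: "curvature_dimension adj x K \<N>"
    \<comment> \<open>The test data \<open>h = 0\<close>, \<open>m = 1\<close> isolate the
      constants.\<close>
    have "d * K \<le> d * ?u"
      using curvature_dimension_necessary[OF cd, of "\<lambda>_. 0" 1]
      by (simp add: inner_on_def mat_vec_def power2_eq_square algebra_simps)
    then have "K \<le> ?u" using d0 by simp
    moreover have "inner_on S k k \<noteq> 0"
      using k by (auto simp: eigenvector_on_def inner_on_self_eq_0_iff finite_nbrs)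
    then have kk: "inner_on S k k > 0"
      using inner_on_self_nonneg[of S k] by simp
    have "inner_on S (?b k) (?b k) = inner_on S (\<lambda>u. (\<mu> - \<alpha> / 2) * k u) (\<lambda>u. (\<mu> - \<alpha> / 2) * k u)"
      using k by (intro inner_on_cong) (simp_all add: eigenvector_on_iff algebra_simps)
    then have "inner_on S (?b k) (?b k) = \<rho> * inner_on S k k"
      unfolding inner_on_linear \<mu> by (simp add: power2_eq_square)
    then have "K * inner_on S k k \<le> ?v * inner_on S k k"
      using curvature_dimension_necessary[OF cd k(2), of 0] by (simp add: algebra_simps)
    then have "K \<le> ?v" using kk by simp
    ultimately show "K \<le> ?u \<and> K \<le> ?v" ..
  next
    assume K: "K \<le> ?u \<and> K \<le> ?v"
    show "curvature_dimension adj x K \<N>"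
      unfolding curvature_dimension_def
    proof
      fix f :: "'a \<Rightarrow> real"
      define m where "m = laplacian adj f x / d"
      define h where "h y = f y - f x - m" for y
      have fS: "\<forall>y\<in>S. f y - f x = h y + m" by (simp add: h_def)
      have h: "(\<Sum>y\<in>S. h y) = 0"
        using d0 by (simp add: h_def sum_subtractf card_nbrs[OF x] m_def laplacian_def)
      note dec = Gamma2_decomposition[OF fS h]
      \<comment> \<open>Once the squares over \<open>T\<close> are dropped and \<open>b\<close> is
        bounded by \<open>\<rho>\<close>, the mean part and the complement part are compared
        separately.\<close>
      have "0 \<le> (\<Sum>z\<in>T. \<beta> / 2 * (f z - f x - 2 / \<beta> * mat_vec S A (\<lambda>y. h y + m) z)\<^sup>2)"
        by (intro sum_nonneg) simp
      moreover have "2 / \<beta> * (\<rho> * inner_on S h h) \<le> 2 / \<beta> * inner_on S (?b h) (?b h)"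
        using \<rho>[OF h] by (intro mult_left_mono) auto
      moreover have "K * (d * m\<^sup>2) \<le> ?u * (d * m\<^sup>2)" "K * inner_on S h h \<le> ?v * inner_on S h h"
        using K by (auto intro!: mult_right_mono inner_on_self_nonneg)
      ultimately have "2 * ?r * (d * m)\<^sup>2 + K * (d * m\<^sup>2 + inner_on S h h) \<le> 2 * Gamma2 adj f f x"
        unfolding dec(3) by (simp add: algebra_simps power2_eq_square)
      then show "?r * (laplacian adj f x)\<^sup>2 + K * Gamma adj f f x \<le> Gamma2 adj f f x"
        unfolding dec(1) dec(2)[symmetric] by simp
    qed
  qed
  then show ?thesis
    unfolding \<rho>_def[symmetric] neg_part_def by (auto simp: min_def)
qed

end

theorem theorem11p1:
  fixes V :: "'a set" and adj :: "'a \<Rightarrow> 'a \<Rightarrow> bool"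
    and N d \<alpha> \<beta> :: nat and x :: 'a and \<N> :: ereal
  assumes "strongly_regular V adj N d \<alpha> \<beta>"
    and "\<beta> \<ge> 1"
    and "x \<in> V"
    and "0 < \<N>"
  shows "BE_curvature adj x \<N> =
    2 + real \<alpha> / 2 - 2 * real d * recip \<N>
    + neg_part
        ((2 * real d * (real \<beta> - 2) - (real \<alpha>)\<^sup>2) / (2 * real \<beta>)
         + 2 * real d * recip \<N>
         + 2 / real \<beta> *
           Min ((\<lambda>\<mu>. (\<mu> - real \<alpha> / 2)\<^sup>2) ` spectrum_ones_perp (nbrs adj x) (adj_matrix adj)))"
proof -
  interpret srg_vertex V adj N d \<alpha> \<beta> x
    using assms(1-3) by unfold_locales
  show ?thesis
    unfolding BE_curvature_def curvature_dimension_iff by (rule Greatest_equality) auto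
qed

end
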